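(* For all integers $m,d\geq 1$, letting $\zeta_m$ be a primitive $m$th root of unity and $\mathrm{Tr}_m:\mathbb{Q}(\zeta_m)\to\mathbb{Q}$ the field trace, \[ \mathrm{Tr}_m(M_d(\zeta_m))=\begin{cases}\mu(m/d) & \text{if } d\mid m,\\ 0 & \text{otherwise.}\end{cases} \]
   Context: $M_d(x)=\frac1d\sum_{e\mid d}\mu(e)x^{d/e}$ is the $d$th necklace polynomial and $\mu$ is the Möbius function. $\mathrm{Tr}_m(\alpha)=\sum_{\sigma\in\mathrm{Gal}(\mathbb{Q}(\zeta_m)/\mathbb{Q})}\sigma(\alpha)$. *)

theory Defs
  imports
    "HOL-Algebra.Algebraic_Closure_Type"
    "HOL-Algebra.Generated_Fields"
    Complex_Main
begin

definition moebius_mu :: "nat \<Rightarrow> int" where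
  "moebius_mu n = (if squarefree n then (-1) ^ card (prime_factors n) else 0)"

definition necklace_poly :: "nat \<Rightarrow> rat poly" where
  "necklace_poly d =
     Polynomial.smult (1 / of_nat d)
       (\<Sum>e | e dvd d. Polynomial.monom (of_int (moebius_mu e)) (d div e))"

definition primitive_root_of_unity :: "nat \<Rightarrow> complex \<Rightarrow> bool" where
  "primitive_root_of_unity m z \<longleftrightarrow> m > 0 \<and> z ^ m = 1 \<and> (\<forall>k. 0 < k \<and> k < m \<longrightarrow> z ^ k \<noteq> 1)"

definition rat_adjoin :: "complex \<Rightarrow> complex set" where
  "rat_adjoin z = generate_field (ring_of_type_algebra :: complex ring) (\<rat> \<union> {z})"

definition subfield_ring :: "complex set \<Rightarrow> complex ring" where
  "subfield_ring L = (ring_of_type_algebra :: complex ring)\<lparr>carrier := L\<rparr>"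

text \<open>Intersecting with \<^term>\<open>extensional L\<close> makes each automorphism of \<^term>\<open>L\<close> be represented
  by exactly one function on the complex numbers, so that sums over the group count it once.\<close>

definition galois_group :: "complex set \<Rightarrow> complex set \<Rightarrow> (complex \<Rightarrow> complex) set" where
  "galois_group L K =
     {\<sigma> \<in> ring_iso (subfield_ring L) (subfield_ring L) \<inter> extensional L. \<forall>x\<in>K. \<sigma> x = x}"

definition cyclotomic_trace :: "complex \<Rightarrow> complex \<Rightarrow> complex" where
  "cyclotomic_trace z \<alpha> = (\<Sum>\<sigma>\<in>galois_group (rat_adjoin z) \<rat>. \<sigma> \<alpha>)"

end

theory Submission
  imports Defs
begin

text \<open>
  The conjugates of a primitive \<open>m\<close>-th root of unity \<open>z\<close> are the powers \<open>z ^ a\<close> with \<open>a\<close> coprime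
  to \<open>m\<close>. The trace of \<open>z ^ k\<close> is therefore a Ramanujan sum, equal to the sum of
  \<open>g \<mu>(m/g)\<close> over the common divisors \<open>g\<close> of \<open>m\<close> and \<open>k\<close>; in the Moebius combination defining
  the necklace polynomial only \<open>g = d\<close> survives.

  For the conjugates we follow Landau. If an integer polynomial \<open>P\<close> vanishes at a root of unity
  \<open>w\<close> and \<open>p\<close> is prime, then \<open>P(x ^ p) \<equiv> P(x) ^ p\<close> modulo \<open>p\<close> gives \<open>P(w ^ p) \<in> p \<int>[w]\<close>. The
  number \<open>P(w ^ p)\<close> takes finitely many values, and a nonzero one lies in \<open>p \<int>[w]\<close> for finitely
  many \<open>p\<close> only, so \<open>P(w ^ p) = 0\<close> for all large \<open>p\<close>. Every \<open>a\<close> coprime to \<open>m\<close> is congruent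
  modulo \<open>m\<close> to a product of such large primes, hence \<open>P(z) = 0\<close> implies \<open>P(z ^ a) = 0\<close>.
\<close>

subsection \<open>Ring homomorphisms on polynomials\<close>

text \<open>Serves the embeddings of the integers and of the rationals alike; preservation of zero
  is derived from additivity.\<close>

context
  fixes h :: "'a::comm_ring_1 \<Rightarrow> 'b::comm_ring_1"
  assumes h_add: "\<And>x y. h (x + y) = h x + h y"
    and h_mult: "\<And>x y. h (x * y) = h x * h y"
    and h_one: "h 1 = 1"
begin

lemma hom_zero: "h 0 = 0"
  using h_add[of 0 0] by simp

lemma map_poly_hom_add: "map_poly h (p + q) = map_poly h p + map_poly h q"
  by (rule poly_eqI) (simp add: coeff_map_poly hom_zero h_add)

lemma map_poly_hom_smult: "map_poly h (Polynomial.smult c p) = Polynomial.smult (h c) (map_poly h p)"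
  by (rule poly_eqI) (simp add: coeff_map_poly hom_zero h_mult)

lemma map_poly_hom_mult: "map_poly h (p * q) = map_poly h p * map_poly h q"
  by (induction p)
     (simp_all add: map_poly_pCons hom_zero map_poly_hom_add map_poly_hom_smult)

lemma map_poly_hom_uminus: "map_poly h (- p) = - map_poly h p"
proof -
  have "map_poly h (- p) + map_poly h p = map_poly h (- p + p)"
    by (rule map_poly_hom_add [symmetric])
  then show ?thesis by (simp add: eq_neg_iff_add_eq_0)
qed

lemma map_poly_hom_diff: "map_poly h (p - q) = map_poly h p - map_poly h q"
  using map_poly_hom_add[of p "- q"] by (simp add: map_poly_hom_uminus)

lemma map_poly_hom_power: "map_poly h (p ^ n) = map_poly h p ^ n"
  by (induction n) (simp_all add: map_poly_hom_mult h_one)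

lemma map_poly_hom_pcompose: "map_poly h (pcompose p q) = pcompose (map_poly h p) (map_poly h q)"
  by (induction p)
     (simp_all add: map_poly_pCons hom_zero pcompose_pCons map_poly_hom_add map_poly_hom_mult)

lemma map_poly_hom_sum: "map_poly h (sum f A) = (\<Sum>x\<in>A. map_poly h (f x))"
  by (induction A rule: infinite_finite_induct) (simp_all add: map_poly_hom_add)

end

lemmas map_poly_of_int =
  map_poly_hom_add[where h = "of_int :: int \<Rightarrow> complex", OF of_int_add of_int_mult of_int_1]
  map_poly_hom_diff[where h = "of_int :: int \<Rightarrow> complex", OF of_int_add of_int_mult of_int_1]
  map_poly_hom_mult[where h = "of_int :: int \<Rightarrow> complex", OF of_int_add of_int_mult of_int_1]
  map_poly_hom_power[where h = "of_int :: int \<Rightarrow> complex", OF of_int_add of_int_mult of_int_1]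
  map_poly_hom_smult[where h = "of_int :: int \<Rightarrow> complex", OF of_int_add of_int_mult of_int_1]
  map_poly_hom_pcompose[where h = "of_int :: int \<Rightarrow> complex", OF of_int_add of_int_mult of_int_1]

lemmas map_poly_of_rat =
  map_poly_hom_add[where h = "of_rat :: rat \<Rightarrow> complex", OF of_rat_add of_rat_mult of_rat_1]
  map_poly_hom_uminus[where h = "of_rat :: rat \<Rightarrow> complex", OF of_rat_add of_rat_mult of_rat_1]
  map_poly_hom_diff[where h = "of_rat :: rat \<Rightarrow> complex", OF of_rat_add of_rat_mult of_rat_1]
  map_poly_hom_mult[where h = "of_rat :: rat \<Rightarrow> complex", OF of_rat_add of_rat_mult of_rat_1]
  map_poly_hom_smult[where h = "of_rat :: rat \<Rightarrow> complex", OF of_rat_add of_rat_mult of_rat_1]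
  map_poly_hom_pcompose[where h = "of_rat :: rat \<Rightarrow> complex", OF of_rat_add of_rat_mult of_rat_1]
  map_poly_hom_sum[where h = "of_rat :: rat \<Rightarrow> complex", OF of_rat_add of_rat_mult of_rat_1]

abbreviation int_eval :: "int poly \<Rightarrow> complex \<Rightarrow> complex" where
  "int_eval p z \<equiv> poly (map_poly of_int p) z"

abbreviation rat_eval :: "rat poly \<Rightarrow> complex \<Rightarrow> complex" where
  "rat_eval p z \<equiv> poly (map_poly of_rat p) z"

lemma power_mod_root_of_unity:
  fixes z :: "'a::monoid_mult"
  assumes "z ^ m = 1"
  shows "z ^ (n mod m) = z ^ n"
proof -
  have "z ^ n = z ^ (m * (n div m) + n mod m)" by simp
  also have "\<dots> = z ^ (n mod m)" by (simp only: power_add power_mult assms power_one mult_1)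
  finally show ?thesis ..
qed

lemma monom_1_minus_1_neq_0:
  assumes "m > 0"
  shows "monom 1 m - 1 \<noteq> (0 :: 'a::comm_ring_1 poly)"
proof
  assume "monom 1 m - 1 = (0 :: 'a poly)"
  then have "degree (monom 1 m :: 'a poly) = degree (1 :: 'a poly)" by simp
  then show False using assms by (simp add: degree_monom_eq)
qed

subsection \<open>Conjugates of roots of unity\<close>

lemma prime_dvd_power_add_diff:
  fixes a b :: "'a::comm_ring_1"
  assumes "prime p"
  shows "of_nat p dvd (a + b) ^ p - a ^ p - b ^ p"
proof -
  have p: "p > 0" using assms prime_gt_0_nat by blast
  have "(a + b) ^ p = (\<Sum>k\<le>p. of_nat (p choose k) * a ^ k * b ^ (p - k))"
    by (rule binomial_ring)
  also have "{..p} = insert 0 (insert p {0<..<p})" using p by auto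
  also have "(\<Sum>k\<in>\<dots>. of_nat (p choose k) * a ^ k * b ^ (p - k)) =
      b ^ p + (a ^ p + (\<Sum>k\<in>{0<..<p}. of_nat (p choose k) * a ^ k * b ^ (p - k)))"
    using p by (subst sum.insert; simp)+
  finally have "(a + b) ^ p - a ^ p - b ^ p =
      (\<Sum>k\<in>{0<..<p}. of_nat (p choose k) * a ^ k * b ^ (p - k))"
    by simp
  moreover have "of_nat p dvd (of_nat (p choose k) :: 'a)" if "k \<in> {0<..<p}" for k
  proof -
    have "p dvd (p choose k)" using that assms by (intro dvd_choose_prime) auto
    then show ?thesis by (metis dvd_def of_nat_mult)
  qed
  ultimately show ?thesis by (auto intro!: dvd_sum dvd_mult2)
qed

text \<open>Fermat's little theorem. The congruence for a power of a sum, with second summand 1,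
  carries the claim up and down from 0, so negative integers need no separate sign argument.\<close>

lemma prime_dvd_power_int_diff:
  fixes a :: int
  assumes "prime p"
  shows "int p dvd a ^ p - a"
proof (induction a rule: int_induct[where k = 0])
  case base
  show ?case using prime_gt_0_nat[OF assms] by (simp add: power_0_left)
next
  case (step1 i)
  have "int p dvd ((i + 1) ^ p - i ^ p - 1 ^ p) + (i ^ p - i)"
    using prime_dvd_power_add_diff[OF assms, of i 1] step1 by (intro dvd_add) auto
  then show ?case by (simp add: algebra_simps)
next
  case (step2 i)
  have "i - 1 + 1 = i" by simp
  then have "int p dvd i ^ p - (i - 1) ^ p - 1"
    using prime_dvd_power_add_diff[OF assms, of "i - 1" 1] by (simp only: of_nat_id power_one)
  from dvd_diff[OF step2.IH this] show ?case by (simp add: algebra_simps)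
qed

text \<open>Induction on the coefficients: modulo \<open>p\<close>, the power
  \<open>(a + x P)^p\<close> splits into \<open>a^p + x^p P^p\<close>. Fermat's theorem replaces
  \<open>a^p\<close> by \<open>a\<close>, and the induction hypothesis replaces \<open>P^p\<close>
  by \<open>P(x^p)\<close>.\<close>

lemma prime_dvd_pcompose_diff_power:
  fixes P :: "int poly"
  assumes "prime p"
  shows "of_nat p dvd pcompose P (monom 1 p) - P ^ p"
proof (induction P)
  case 0
  show ?case using prime_gt_0_nat[OF assms] by (simp add: power_0_left)
next
  case (pCons a P)
  have fermat: "int p dvd a - a ^ p"
    using prime_dvd_power_int_diff[OF assms, of a] by (simp add: dvd_diff_commute)
  have "of_nat p dvd [:a - a ^ p:]" using fermat
    by (simp add: of_nat_poly)
  moreover have "[:a - a ^ p:] = [:a:] - [:a:] ^ p"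
    by (simp add: poly_const_pow)
  ultimately have 1: "of_nat p dvd [:a:] - [:a:] ^ p" by simp
  have 2: "of_nat p dvd monom 1 p * (pcompose P (monom 1 p) - P ^ p)"
    using pCons.IH by (rule dvd_mult)
  have 3: "of_nat p dvd ([:a:] + monom 1 1 * P) ^ p - [:a:] ^ p - (monom 1 1 * P) ^ p"
    by (rule prime_dvd_power_add_diff[OF assms])
  have eq: "pCons a P = [:a:] + monom 1 1 * P"
    by (simp add: monom_Suc)
  have "pcompose (pCons a P) (monom 1 p) - pCons a P ^ p =
      ([:a:] - [:a:] ^ p) + monom 1 p * (pcompose P (monom 1 p) - P ^ p)
      - (([:a:] + monom 1 1 * P) ^ p - [:a:] ^ p - (monom 1 1 * P) ^ p)"
    unfolding eq[symmetric]
    by (simp add: pcompose_pCons power_mult_distrib monom_power algebra_simps)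
  then show ?case using 1 2 3 by (metis dvd_add dvd_diff)
qed

lemma int_eval_prime_power:
  assumes "prime p" "int_eval P z = 0"
  shows "\<exists>Q. int_eval P (z ^ p) = of_nat p * int_eval Q z"
proof -
  obtain Q where Q: "pcompose P (monom 1 p) - P ^ p = of_nat p * Q"
    using prime_dvd_pcompose_diff_power[OF assms(1)] by (auto elim: dvdE)
  then have "pcompose P (monom 1 p) = P ^ p + Polynomial.smult (int p) Q"
    by (simp add: of_nat_poly algebra_simps)
  then have "int_eval (pcompose P (monom 1 p)) z = int_eval (P ^ p + Polynomial.smult (int p) Q) z"
    by simp
  then have "int_eval P (z ^ p) = of_nat p * int_eval Q z"
    using assms prime_gt_0_nat[OF assms(1)]
    by (simp add: map_poly_of_int map_poly_monom poly_pcompose poly_monom power_0_left)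
  then show ?thesis ..
qed

text \<open>
  Modulo an integer polynomial of minimal degree that kills \<open>z\<close>, with leading coefficient \<open>c\<close>, every
  element of \<open>\<int>[z]\<close> times a power of \<open>c\<close> has unique integer coordinates. A prime not
  dividing \<open>c\<close> that divides the element divides all its coordinates.
\<close>

lemma int_eval_eq_prime_mult_bound:
  assumes alg: "\<exists>D. D \<noteq> 0 \<and> int_eval D z = 0"
    and nz: "int_eval R z \<noteq> 0"
  shows "\<exists>B. \<forall>p Q. prime p \<longrightarrow> int_eval R z = of_nat p * int_eval Q z \<longrightarrow> p \<le> B"
proof -
  obtain D where D: "D \<noteq> 0" "int_eval D z = 0"
    and min: "\<And>E. E \<noteq> 0 \<Longrightarrow> int_eval E z = 0 \<Longrightarrow> degree D \<le> degree E"
    using ex_has_least_nat[of "\<lambda>D. D \<noteq> 0 \<and> int_eval D z = 0" _ degree] alg by blast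
  define c where "c = lead_coeff D"
  have c: "c \<noteq> 0" using D by (simp add: c_def)
  have red: "\<exists>k s. int_eval s z = of_int (c ^ k) * int_eval Q z \<and> (s = 0 \<or> degree s < degree D)" for Q
  proof -
    obtain q s where qs: "pseudo_divmod Q D = (q, s)" by fastforce
    from pseudo_divmod[OF D(1) this] have
      eq: "Polynomial.smult (c ^ (Suc (degree Q) - degree D)) Q = D * q + s" 
      and deg: "s = 0 \<or> degree s < degree D"
      by (auto simp: c_def)
    have "int_eval (D * q + s) z = of_int (c ^ (Suc (degree Q) - degree D)) * int_eval Q z"
      unfolding eq[symmetric] by (simp add: map_poly_of_int)
    then show ?thesis using D deg by (auto simp: map_poly_of_int)
  qed
  obtain k r where r: "int_eval r z = of_int (c ^ k) * int_eval R z" "r = 0 \<or> degree r < degree D"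
    using red by blast
  have r0: "r \<noteq> 0" using r nz c by auto
  define l where "l = lead_coeff r"
  have l: "l \<noteq> 0" using r0 by (simp add: l_def)
  have "p \<le> nat (max \<bar>c\<bar> \<bar>l\<bar>)" if p: "prime p" and Q: "int_eval R z = of_nat p * int_eval Q z" for p Q
  proof -
    obtain j s where s: "int_eval s z = of_int (c ^ j) * int_eval Q z" "s = 0 \<or> degree s < degree D"
      using red by blast
    \<comment> \<open>The relation \<open>R(z) = p Q(z)\<close>, multiplied by
      \<open>c ^ (j + k)\<close> and rewritten with the reduced representatives. It kills
      \<open>z\<close> below the minimal degree, so \<open>E = 0\<close>; its coefficient at
      \<open>degree r\<close> then shows that \<open>p\<close> divides \<open>c ^ j * l\<close>,
      where \<open>c\<close> and \<open>l\<close> were fixed before \<open>p\<close> and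
      \<open>Q\<close>.\<close>
    define E where "E = Polynomial.smult (c ^ j) r - Polynomial.smult (int p * c ^ k) s"
    have "degree r < degree D" using r r0 by auto
    moreover from this have "degree s < degree D" using s by auto
    ultimately have "degree E < degree D"
      unfolding E_def by (meson degree_diff_less degree_smult_le le_less_trans)
    moreover have "int_eval E z = 0"
      by (simp add: E_def map_poly_of_int r s Q)
    ultimately have "E = 0" using min by force
    then have "coeff E (degree r) = 0" by simp
    then have "c ^ j * l = int p * (c ^ k * coeff s (degree r))"
      by (simp add: E_def l_def)
    then have "int p dvd c ^ j * l" by simp
    moreover have "prime (int p)" using p by simp
    ultimately have "int p dvd c \<or> int p dvd l"
      using prime_dvd_multD prime_dvd_power by blast
    then have "\<bar>int p\<bar> \<le> \<bar>c\<bar> \<or> \<bar>int p\<bar> \<le> \<bar>l\<bar>"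
      using c l dvd_imp_le_int by blast
    then show ?thesis by linarith
  qed
  then show ?thesis by blast
qed

text \<open>The values involved depend on \<open>j\<close> and \<open>p\<close> only modulo
  \<open>m\<close>, so the maximum of finitely many bounds works for all \<open>j\<close> and
  \<open>p\<close> at once.\<close>

lemma int_eval_root_of_unity_large_prime:
  assumes m: "m > 0" and z: "z ^ m = 1"
  shows "\<exists>B. \<forall>p j. prime p \<longrightarrow> p > B \<longrightarrow> int_eval P (z ^ j) = 0 \<longrightarrow> int_eval P (z ^ (j * p)) = 0"
proof -
  note zmod = power_mod_root_of_unity[OF z]
  \<comment> \<open>Here \<open>i\<close> stands for the residue of \<open>p\<close>. Divisibility
    is taken in the ring generated by \<open>z ^ j\<close>, because the Frobenius congruence will be
    evaluated at that point.\<close>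
  define W where "W i j B \<longleftrightarrow> (\<forall>p Q. prime p \<longrightarrow> int_eval P (z ^ (j * i)) \<noteq> 0 \<longrightarrow>
      int_eval P (z ^ (j * i)) = of_nat p * int_eval Q (z ^ j) \<longrightarrow> p \<le> B)" for i j B
  have "\<exists>B. W i j B" for i j
  proof (cases "int_eval P (z ^ (j * i)) = 0")
    case False
    have eq: "int_eval P (z ^ (j * i)) = int_eval (pcompose P (monom 1 i)) (z ^ j)"
      by (simp add: map_poly_of_int map_poly_monom poly_pcompose poly_monom power_mult)
    have "monom 1 m - 1 \<noteq> (0 :: int poly)"
      by (rule monom_1_minus_1_neq_0[OF m])
    moreover have "int_eval (monom 1 m - 1) (z ^ j) = 0"
      by (simp add: map_poly_of_int map_poly_monom poly_monom flip: power_mult)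
         (metis mult.commute power_mult power_one z)
    ultimately show ?thesis using int_eval_eq_prime_mult_bound[of "z ^ j" "pcompose P (monom 1 i)"] False
      unfolding W_def eq by blast
  qed (auto simp: W_def)
  then obtain B where B: "\<And>i j. W i j (B i j)" by metis
  define C where "C = Max ((\<lambda>(i, j). B i j) ` ({..<m} \<times> {..<m}))"
  have C: "B i j \<le> C" if "i < m" "j < m" for i j
    unfolding C_def using that by (intro Max_ge) auto
  have "int_eval P (z ^ (j * p)) = 0" if p: "prime p" "p > C" and 0: "int_eval P (z ^ j) = 0" for p j
  proof (rule ccontr)
    assume nz: "int_eval P (z ^ (j * p)) \<noteq> 0"
    have e: "z ^ (j * p) = z ^ ((j mod m) * (p mod m))"
      by (metis zmod mod_mult_eq)
    obtain Q where "int_eval P ((z ^ j) ^ p) = of_nat p * int_eval Q (z ^ j)"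
      using int_eval_prime_power[OF p(1) 0] by blast
    then have "int_eval P (z ^ (j mod m * (p mod m))) = of_nat p * int_eval Q (z ^ (j mod m))"
      by (simp add: zmod flip: e power_mult)
    then have "p \<le> B (p mod m) (j mod m)"
      using B[of "p mod m" "j mod m"] nz p(1) unfolding W_def e by blast
    then show False using C[of "p mod m" "j mod m"] m p by simp
  qed
  then show ?thesis by blast
qed

text \<open>The exponent \<open>a\<close> itself may have small prime factors, to which the
  large-prime step does not apply; \<open>n\<close> is a representative of the same class without
  them.\<close>

lemma coprime_cong_large_prime_factors:
  fixes a m B :: nat
  assumes "m > 0" "coprime a m"
  shows "\<exists>n>0. n mod m = a mod m \<and> (\<forall>q. prime q \<longrightarrow> q dvd n \<longrightarrow> q > B)"
proof -
  define S where "S = {q. prime q \<and> q \<le> B \<and> \<not> q dvd a}"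
  have fin: "finite S" unfolding S_def by (rule finite_subset[of _ "{..B}"]) auto
  \<comment> \<open>A prime \<open>q \<le> B\<close> divides exactly one of the two summands.\<close>
  define n where "n = a + m * \<Prod>S"
  have "\<Prod>S > 0" by (rule prod_pos) (auto simp: S_def prime_gt_0_nat)
  then have "n > 0" using assms(1) by (simp add: n_def)
  moreover have "n mod m = a mod m" by (simp add: n_def)
  moreover have "q > B" if q: "prime q" "q dvd n" for q
  proof (rule ccontr)
    assume le: "\<not> q > B"
    show False
    proof (cases "q dvd a")
      case True
      then have "q dvd m * \<Prod>S" using q by (simp add: n_def dvd_add_right_iff)
      moreover have "\<not> q dvd m" using True assms q by (metis coprime_common_divisor not_prime_unit)
      ultimately have "q dvd \<Prod>S" using q by (simp add: prime_dvd_mult_iff)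
      then obtain s where "s \<in> S" "q dvd s" using q fin by (auto simp: prime_dvd_prod_iff)
      then show False using True q primes_dvd_imp_eq by (auto simp: S_def)
    next
      case False
      then have "q dvd \<Prod>S" using q le fin by (intro dvd_prodI) (auto simp: S_def)
      then show False using False q by (simp add: n_def dvd_add_left_iff)
    qed
  qed
  ultimately show ?thesis by blast
qed

text \<open>Starting from the exponent 1, the prime factors of a suitable \<open>n\<close> congruent
  to \<open>a\<close> are multiplied in one at a time, each step preserving the vanishing of
  \<open>P\<close>.\<close>

lemma int_eval_root_of_unity_coprime:
  assumes m: "m > 0" and z: "z ^ m = 1" and P: "int_eval P z = 0" and a: "coprime a m"
  shows "int_eval P (z ^ a) = 0"
proof -
  obtain B where B: "\<And>p j. prime p \<Longrightarrow> p > B \<Longrightarrow> int_eval P (z ^ j) = 0 \<Longrightarrow> int_eval P (z ^ (j * p)) = 0"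
    using int_eval_root_of_unity_large_prime[OF m z] by blast
  obtain n where n: "n > 0" "n mod m = a mod m" "\<And>q. prime q \<Longrightarrow> q dvd n \<Longrightarrow> q > B"
    using coprime_cong_large_prime_factors[OF m a] by blast
  have "int_eval P (z ^ n) = 0" if "n > 0" "\<And>q. prime q \<Longrightarrow> q dvd n \<Longrightarrow> q > B" for n
    using that
  proof (induction n rule: prime_divisors_induct)
    case (factor p x)
    then have "int_eval P (z ^ x) = 0" by simp
    then show ?case using factor B[of p x] by (simp add: mult.commute)
  qed (use P in auto)
  then have "int_eval P (z ^ n) = 0" using n by blast
  moreover have "z ^ n = z ^ a"
    using n(2) power_mod_root_of_unity[OF z] by metis
  ultimately show ?thesis by simp
qed

section \<open>Transfer to rational polynomials\<close>

lemma rat_poly_clear_denominators: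
  fixes p :: "rat poly"
  shows "\<exists>N Q. N > 0 \<and> Polynomial.smult (of_nat N) p = map_poly of_int Q"
proof (induction p)
  case 0
  show ?case by (rule exI[of _ 1], rule exI[of _ 0]) simp
next
  case (pCons a p)
  then obtain N Q where NQ: "N > 0" "Polynomial.smult (of_nat N) p = map_poly of_int Q" by blast
  obtain u v where uv: "quotient_of a = (u, v)" by fastforce
  then have v: "v > 0" and a: "a = of_int u / of_int v"
    using quotient_of_denom_pos quotient_of_div by blast+
  have "Polynomial.smult (of_nat (N * nat v)) (pCons a p) =
      map_poly of_int (pCons (int N * u) (Polynomial.smult v Q))"
    using v a NQ(2)
    by (simp add: map_poly_pCons map_poly_hom_smult flip: NQ(2)) (simp add: mult.commute)
  then show ?case using NQ v by (metis mult_pos_pos zero_less_nat_eq)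
qed

lemma rat_eval_root_of_unity_coprime:
  assumes "m > 0" "z ^ m = 1" "rat_eval P z = 0" "coprime a m"
  shows "rat_eval P (z ^ a) = 0"
proof -
  obtain N Q where NQ: "N > 0" "Polynomial.smult (of_nat N) P = map_poly of_int Q"
    using rat_poly_clear_denominators by blast
  have eq: "of_nat N * rat_eval P x = int_eval Q x" for x
  proof -
    have "of_nat N * rat_eval P x = rat_eval (Polynomial.smult (of_nat N) P) x"
      by (simp add: map_poly_of_rat)
    also have "\<dots> = int_eval Q x"
      unfolding NQ(2) by (simp add: map_poly_map_poly o_def)
    finally show ?thesis .
  qed
  have "int_eval Q (z ^ a) = 0"
    using assms by (intro int_eval_root_of_unity_coprime[of m]) (simp_all flip: eq)
  then show ?thesis using NQ by (simp flip: eq)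
qed

subsection \<open>The Galois group of a cyclotomic field\<close>

lemma ring_of_type_algebra_simps:
  "carrier ring_of_type_algebra = UNIV"
  "x \<otimes>\<^bsub>ring_of_type_algebra\<^esub> y = x * y"
  "x \<oplus>\<^bsub>ring_of_type_algebra\<^esub> y = x + y"
  "\<one>\<^bsub>ring_of_type_algebra\<^esub> = 1"
  "\<zero>\<^bsub>ring_of_type_algebra\<^esub> = 0"
  by (simp_all add: ring_of_type_algebra_def)

lemma a_inv_ring_of_type_algebra: "\<ominus>\<^bsub>ring_of_type_algebra\<^esub> x = - (x :: 'a :: comm_ring_1)"
proof -
  interpret cring "ring_of_type_algebra :: 'a ring" by (rule cring_from_type_algebra)
  show ?thesis
    by (rule minus_equality) (simp_all add: ring_of_type_algebra_simps)
qed

lemma m_inv_ring_of_type_algebra: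
  fixes x :: "'a :: Fields.field"
  assumes "x \<noteq> 0"
  shows "inv\<^bsub>ring_of_type_algebra\<^esub> x = inverse x"
proof -
  interpret cring "ring_of_type_algebra :: 'a ring" by (rule cring_from_type_algebra)
  show ?thesis
    by (rule comm_inv_char) (use assms in \<open>simp_all add: ring_of_type_algebra_simps\<close>)
qed

text \<open>If the gcd \<open>g\<close> of \<open>P\<close> and \<open>D\<close> is constant, Bezout
  coefficients give the inverse. Otherwise \<open>g\<close> does not vanish at \<open>z\<close>,
  since it divides \<open>P\<close>; hence the cofactor \<open>h\<close> of \<open>g\<close> in
  \<open>D\<close> kills \<open>z\<close> and has smaller degree.\<close>

lemma rat_eval_inverse:
  assumes "D \<noteq> 0" "rat_eval D z = 0" "rat_eval P z \<noteq> 0"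
  shows "\<exists>U. rat_eval U z * rat_eval P z = 1"
  using assms(1,2)
proof (induction "degree D" arbitrary: D rule: less_induct)
  case less
  define g where "g = gcd P D"
  obtain P' where P': "P = g * P'" unfolding g_def by (meson dvdE gcd_dvd1)
  obtain h where h: "D = g * h" unfolding g_def by (meson dvdE gcd_dvd2)
  have gz: "rat_eval g z \<noteq> 0" using assms(3) by (auto simp: P' map_poly_of_rat)
  have g0: "g \<noteq> 0" and h0: "h \<noteq> 0" using less.prems(1) h by auto
  have hz: "rat_eval h z = 0" using less.prems(2) gz by (simp add: h map_poly_of_rat)
  show ?case
  proof (cases "degree g = 0")
    case True
    then obtain c where c: "g = [:c:]" by (rule degree_eq_zeroE)
    then have "c \<noteq> 0" using g0 by auto
    obtain a b where "a * P + b * D = g" 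
      unfolding g_def using bezout_coefficients_fst_snd[of P D] by blast
    then have "rat_eval (a * P + b * D) z = of_rat c" by (simp add: c map_poly_pCons)
    then have "rat_eval a z * rat_eval P z = of_rat c"
      using less.prems(2) by (simp add: map_poly_of_rat)
    then have "rat_eval (Polynomial.smult (inverse c) a) z * rat_eval P z = 1"
      using \<open>c \<noteq> 0\<close> by (simp add: map_poly_of_rat of_rat_inverse mult.assoc)
    then show ?thesis ..
  next
    case False
    then have "degree h < degree D" by (simp add: h degree_mult_eq g0 h0)
    then show ?thesis using less.hyps h0 hz by blast
  qed
qed

text \<open>Polynomial values are closed under inverses because \<open>z\<close> is algebraic; the
  other inclusion is Horner's scheme.\<close>

lemma rat_adjoin_eq:
  assumes "D \<noteq> 0" "rat_eval D z = 0"
  shows "rat_adjoin z = range (\<lambda>p. rat_eval p z)"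
proof (intro equalityI subsetI)
  fix x assume "x \<in> rat_adjoin z"
  then have "x \<in> generate_field ring_of_type_algebra (\<rat> \<union> {z})" by (simp add: rat_adjoin_def)
  then show "x \<in> range (\<lambda>p. rat_eval p z)"
  proof (induction rule: generate_field.induct)
    case one
    show ?case by (rule range_eqI[of _ _ 1]) (simp add: ring_of_type_algebra_simps)
  next
    case (incl x)
    then consider r where "x = of_rat r" | "x = z" by (auto elim: Rats_cases)
    then show ?case
    proof cases
      case 1
      then show ?thesis by (intro range_eqI[of _ _ "[:r:]"]) (simp add: map_poly_pCons)
    next
      case 2
      then show ?thesis by (intro range_eqI[of _ _ "[:0, 1:]"]) (simp add: map_poly_pCons)
    qed
  next
    case (a_inv x)
    then obtain p where "x = rat_eval p z" by auto
    then show ?case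
      by (intro range_eqI[of _ _ "- p"]) (simp add: a_inv_ring_of_type_algebra map_poly_of_rat)
  next
    case (m_inv x)
    then obtain p where p: "x = rat_eval p z" by auto
    have x: "x \<noteq> 0" using m_inv by (simp add: ring_of_type_algebra_simps)
    then obtain U where "rat_eval U z * x = 1" using rat_eval_inverse assms p by blast
    then have "inverse x = rat_eval U z" using x by (metis inverse_unique mult.commute)
    then show ?case by (simp add: m_inv_ring_of_type_algebra x)
  next
    case (eng_add x y)
    then obtain p q where "x = rat_eval p z" "y = rat_eval q z" by auto
    then show ?case
      by (intro range_eqI[of _ _ "p + q"]) (simp add: ring_of_type_algebra_simps map_poly_of_rat)
  next
    case (eng_mult x y)
    then obtain p q where "x = rat_eval p z" "y = rat_eval q z" by auto
    then show ?case
      by (intro range_eqI[of _ _ "p * q"]) (simp add: ring_of_type_algebra_simps map_poly_of_rat)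
  qed
next
  fix x assume "x \<in> range (\<lambda>p. rat_eval p z)"
  then obtain p where x: "x = rat_eval p z" by auto
  have "rat_eval p z \<in> generate_field ring_of_type_algebra (\<rat> \<union> {z})"
  proof (induction p)
    case 0
    show ?case by (simp add: generate_field.incl)
  next
    case (pCons a p)
    have "of_rat a \<oplus>\<^bsub>ring_of_type_algebra\<^esub> (z \<otimes>\<^bsub>ring_of_type_algebra\<^esub> rat_eval p z)
        \<in> generate_field ring_of_type_algebra (\<rat> \<union> {z})"
      by (intro generate_field.eng_add generate_field.eng_mult pCons.IH generate_field.incl) auto
    then show ?case by (simp add: map_poly_pCons ring_of_type_algebra_simps)
  qed
  then show "x \<in> rat_adjoin z" by (simp add: x rat_adjoin_def)
qed

lemma rat_adjoin_root_of_unity: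
  assumes "m > 0" "z ^ m = 1"
  shows "rat_adjoin z = range (\<lambda>p. rat_eval p z)"
proof (rule rat_adjoin_eq)
  show "monom 1 m - 1 \<noteq> (0 :: rat poly)"
    by (rule monom_1_minus_1_neq_0[OF assms(1)])
  show "rat_eval (monom 1 m - 1) z = 0"
    using assms by (simp add: map_poly_of_rat map_poly_monom poly_monom)
qed

section \<open>Automorphisms and exponents coprime to \<open>m\<close>\<close>

lemma galois_group_iff:
  "\<sigma> \<in> galois_group L K \<longleftrightarrow>
     bij_betw \<sigma> L L \<and> (\<forall>x\<in>L. \<forall>y\<in>L. \<sigma> (x + y) = \<sigma> x + \<sigma> y) \<and>
     (\<forall>x\<in>L. \<forall>y\<in>L. \<sigma> (x * y) = \<sigma> x * \<sigma> y) \<and> \<sigma> 1 = 1 \<and> \<sigma> \<in> extensional L \<and> (\<forall>x\<in>K. \<sigma> x = x)"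
  by (auto simp: galois_group_def subfield_ring_def ring_iso_def ring_hom_def
      ring_of_type_algebra_def bij_betw_def)

text \<open>Shows that an automorphism is determined by its value at \<open>z\<close>. Its
  homomorphism laws hold on \<open>L\<close> only, so each Horner step needs membership of its terms
  in \<open>L\<close>.\<close>

lemma galois_group_rat_eval:
  assumes L: "L = range (\<lambda>p. rat_eval p z)" and \<sigma>: "\<sigma> \<in> galois_group L \<rat>"
  shows "\<sigma> (rat_eval p z) = rat_eval p (\<sigma> z)"
proof (induction p)
  case 0
  have "\<sigma> 0 = 0" using \<sigma> by (simp add: galois_group_iff)
  then show ?case by simp
next
  case (pCons a p)
  have mem: "rat_eval q z \<in> L" for q by (simp add: L)
  have z: "z \<in> L" using mem[of "[:0, 1:]"] by (simp add: map_poly_pCons)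
  have a: "of_rat a \<in> L" using mem[of "[:a:]"] by (simp add: map_poly_pCons)
  have "z * rat_eval p z \<in> L" using mem[of "pCons 0 p"] by (simp add: map_poly_pCons)
  then have "\<sigma> (of_rat a + z * rat_eval p z) = \<sigma> (of_rat a) + \<sigma> (z * rat_eval p z)"
    using \<sigma> a by (simp add: galois_group_iff)
  also have "\<dots> = of_rat a + \<sigma> z * rat_eval p (\<sigma> z)"
    using \<sigma> z mem[of p] pCons.IH by (simp add: galois_group_iff)
  finally show ?case by (simp add: map_poly_pCons)
qed

lemma primitive_root_of_unity_power_eq_1_iff:
  assumes "primitive_root_of_unity m z"
  shows "z ^ n = 1 \<longleftrightarrow> m dvd n"
proof
  have m: "m > 0" "z ^ m = 1" using assms by (auto simp: primitive_root_of_unity_def)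
  {
    assume "z ^ n = 1"
    then have "z ^ (n mod m) = 1" by (simp add: power_mod_root_of_unity[OF m(2)])
    moreover have "n mod m < m" using m by simp
    ultimately have "n mod m = 0" using assms by (auto simp: primitive_root_of_unity_def)
    then show "m dvd n" by auto
  next
    assume "m dvd n"
    then show "z ^ n = 1" using m by (auto elim!: dvdE simp: power_mult)
  }
qed

lemma primitive_root_of_unity_inj_on:
  assumes "primitive_root_of_unity m z"
  shows "inj_on (\<lambda>a. z ^ a) {..<m}"
proof (rule linorder_inj_onI')
  have "z \<noteq> 0" using assms by (auto simp: primitive_root_of_unity_def power_0_left)
  fix i j assume ij: "i \<in> {..<m}" "j \<in> {..<m}" "i < j"
  show "z ^ i \<noteq> z ^ j"
  proof
    assume "z ^ i = z ^ j"
    also have "z ^ j = z ^ i * z ^ (j - i)" using ij by (simp flip: power_add)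
    finally have "z ^ (j - i) = 1" using \<open>z \<noteq> 0\<close> by simp
    then have "m dvd j - i" using primitive_root_of_unity_power_eq_1_iff[OF assms] by simp
    then show False using ij by (auto dest: dvd_imp_le)
  qed
qed

text \<open>By counting: the \<open>m\<close> distinct powers of \<open>z\<close> exhaust the
  \<open>m\<close> complex roots of \<open>w ^ m = 1\<close>.\<close>

lemma primitive_root_of_unity_generates:
  assumes "primitive_root_of_unity m z" "w ^ m = 1"
  shows "\<exists>a<m. w = z ^ a"
proof -
  have m: "m > 0" "z ^ m = 1" using assms by (auto simp: primitive_root_of_unity_def)
  have "(\<lambda>a. z ^ a) ` {..<m} = {w. w ^ m = 1}"
  proof (rule card_subset_eq)
    show "finite {w :: complex. w ^ m = 1}" using m by (intro finite_roots_unity) auto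
    show "(\<lambda>a. z ^ a) ` {..<m} \<subseteq> {w. w ^ m = 1}"
      using m by (auto simp flip: power_mult) (metis mult.commute power_mult power_one)
    show "card ((\<lambda>a. z ^ a) ` {..<m}) = card {w :: complex. w ^ m = 1}"
      using m primitive_root_of_unity_inj_on[OF assms(1)]
      by (simp add: card_image card_roots_unity_eq)
  qed
  then show ?thesis using assms(2) by auto
qed

text \<open>The image of \<open>z\<close> is an \<open>m\<close>-th root of unity, hence some
  \<open>z ^ a\<close>. With \<open>g = gcd a m\<close>, both \<open>z ^ (m div g)\<close> and 1 are
  sent to 1, so injectivity and the order of \<open>z\<close> force \<open>g = 1\<close>.\<close>

lemma galois_group_apply_root:
  assumes prim: "primitive_root_of_unity m z" and \<sigma>: "\<sigma> \<in> galois_group (rat_adjoin z) \<rat>"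
  shows "\<exists>a<m. coprime a m \<and> \<sigma> z = z ^ a"
proof -
  have m: "m > 0" "z ^ m = 1" using prim by (auto simp: primitive_root_of_unity_def)
  note L = rat_adjoin_root_of_unity[OF m]
  have pow: "\<sigma> (z ^ n) = \<sigma> z ^ n" for n
    using galois_group_rat_eval[OF L \<sigma>, of "monom 1 n"] by (simp add: map_poly_monom poly_monom)
  have one: "\<sigma> 1 = 1" using \<sigma> by (simp add: galois_group_iff)
  have inj: "inj_on \<sigma> (rat_adjoin z)" using \<sigma> by (simp add: galois_group_iff bij_betw_def)
  have mem: "z ^ n \<in> rat_adjoin z" for n
    unfolding L by (rule range_eqI[of _ _ "monom 1 n"]) (simp add: map_poly_monom poly_monom)
  have "\<sigma> z ^ m = 1" using pow[of m] m one by simp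
  then obtain a where a: "a < m" "\<sigma> z = z ^ a" using primitive_root_of_unity_generates[OF prim] by blast
  define g where "g = gcd a m"
  have "m dvd a * (m div g)"
    unfolding g_def by (metis div_mult_swap dvd_triv_left gcd_dvd1 gcd_dvd2 mult.commute dvd_div_mult)
  then have "z ^ (a * (m div g)) = 1"
    using primitive_root_of_unity_power_eq_1_iff[OF prim] by blast
  then have "\<sigma> (z ^ (m div g)) = \<sigma> 1" by (simp add: pow a one power_mult)
  then have "z ^ (m div g) = 1" using inj mem[of "m div g"] mem[of 0] by (auto dest: inj_onD)
  then have "m dvd m div g" using primitive_root_of_unity_power_eq_1_iff[OF prim] by blast
  moreover have "m div g > 0" using m by (simp add: g_def div_greater_zero_iff)
  ultimately have "m \<le> m div g" by (rule dvd_imp_le)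
  then have "\<not> 1 < g" using div_less_dividend[of g m] m by linarith
  moreover have "g > 0" using m by (simp add: g_def)
  ultimately have "g = 1" by linarith
  then have "coprime a m" by (simp add: g_def coprime_iff_gcd_eq_1)
  then show ?thesis using a by blast
qed

text \<open>The automorphism sends \<open>p(z)\<close> to \<open>p(z ^ a)\<close>. It is well
  defined because vanishing at \<open>z\<close> passes to \<open>z ^ a\<close>, and bijective
  because an inverse \<open>b\<close> of \<open>a\<close> modulo \<open>m\<close> leads
  back.\<close>

lemma galois_group_exists_power:
  assumes prim: "primitive_root_of_unity m z" and a: "coprime a m"
  shows "\<exists>\<sigma>\<in>galois_group (rat_adjoin z) \<rat>. \<sigma> z = z ^ a"
proof -
  have m: "m > 0" "z ^ m = 1" using prim by (auto simp: primitive_root_of_unity_def)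
  define L where "L = rat_adjoin z"
  have L: "L = range (\<lambda>p. rat_eval p z)" using rat_adjoin_root_of_unity[OF m] by (simp add: L_def)
  have mem: "rat_eval p z \<in> L" for p by (simp add: L)
  obtain b where b: "coprime b m" "z ^ (a * b) = z"
  proof -
    \<comment> \<open>Over the naturals \<open>a * x = 1 + m * y\<close> has no solution for
      \<open>a = 0\<close> and \<open>m = 1\<close>; in the case \<open>m = 1\<close>,
      \<open>z = 1\<close> and any exponent serves.\<close>
    obtain x y where xy: "a * x = 1 + m * y \<or> m = 1"
      using coprime_bezout_strong[OF a] by auto
    show thesis
    proof (cases "m = 1")
      case True
      then show ?thesis using that[of 1] m by simp
    next
      case False
      then have eq: "a * x = 1 + m * y" using xy by simp
      have "coprime (a * x) m"
        unfolding eq by (rule coprimeI) (metis dvd_add_left_iff dvd_mult2)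
      then have "coprime x m" by simp
      moreover have "z ^ (a * x) = z" unfolding eq using m by (simp add: power_mult)
      ultimately show ?thesis using that by blast
    qed
  qed
  have conv: "rat_eval p z = 0" if "rat_eval p (z ^ a) = 0" for p
  proof -
    have "(z ^ a) ^ m = 1" using m by (metis mult.commute power_mult power_one)
    then have "rat_eval p ((z ^ a) ^ b) = 0"
      using rat_eval_root_of_unity_coprime m that b by blast
    then show ?thesis using b by (simp add: power_mult)
  qed
  have same: "rat_eval p z = rat_eval q z \<longleftrightarrow> rat_eval p (z ^ a) = rat_eval q (z ^ a)" for p q
    using rat_eval_root_of_unity_coprime[OF m _ a, of "p - q"] conv[of "p - q"]
    by (auto simp: map_poly_of_rat)
  \<comment> \<open>\<open>SOME\<close> picks any polynomial representing \<open>x\<close>; by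
    \<open>same\<close> the value does not depend on the choice. The restriction supplies
    extensionality.\<close>
  define \<sigma> where "\<sigma> = restrict (\<lambda>x. rat_eval (SOME p. rat_eval p z = x) (z ^ a)) L"
  have \<sigma>: "\<sigma> (rat_eval p z) = rat_eval p (z ^ a)" for p
  proof -
    have "rat_eval (SOME q. rat_eval q z = rat_eval p z) z = rat_eval p z"
      by (rule someI) (rule refl)
    then show ?thesis by (simp add: \<sigma>_def mem same)
  qed
  have power: "rat_eval p (w ^ n) = rat_eval (pcompose p (monom 1 n)) w" for p n w
    by (simp add: map_poly_of_rat map_poly_monom poly_monom poly_pcompose)
  have "bij_betw \<sigma> L L"
  proof (rule bij_betw_imageI)
    show "inj_on \<sigma> L" by (auto simp: inj_on_def L \<sigma> same)
    show "\<sigma> ` L = L"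
    proof (intro equalityI subsetI)
      fix x assume "x \<in> \<sigma> ` L"
      then show "x \<in> L" by (auto simp: L \<sigma> power)
    next
      fix x assume "x \<in> L"
      then obtain p where "x = rat_eval p z" by (auto simp: L)
      \<comment> \<open>Substituting \<open>x^b\<close> into \<open>p\<close> gives the
        preimage.\<close>
      then have "x = rat_eval p ((z ^ a) ^ b)" using b by (simp add: power_mult)
      then have "x = \<sigma> (rat_eval (pcompose p (monom 1 b)) z)" by (simp only: power \<sigma>)
      then show "x \<in> \<sigma> ` L" using mem by blast
    qed
  qed
  moreover have "\<sigma> (x + y) = \<sigma> x + \<sigma> y" "\<sigma> (x * y) = \<sigma> x * \<sigma> y" if "x \<in> L" "y \<in> L" for x y
  proof -
    from that obtain p q where "x = rat_eval p z" "y = rat_eval q z" by (auto simp: L)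
    then show "\<sigma> (x + y) = \<sigma> x + \<sigma> y" "\<sigma> (x * y) = \<sigma> x * \<sigma> y"
      using \<sigma>[of "p + q"] \<sigma>[of "p * q"] by (simp_all add: \<sigma> map_poly_of_rat)
  qed
  moreover have rat: "\<sigma> (of_rat r) = of_rat r" for r
    using \<sigma>[of "[:r:]"] by (simp add: map_poly_pCons)
  moreover have "\<sigma> 1 = 1" using rat[of 1] by simp
  moreover have "\<sigma> \<in> extensional L" by (simp add: \<sigma>_def)
  ultimately have "\<sigma> \<in> galois_group L \<rat>" by (auto simp: galois_group_iff elim!: Rats_cases)
  moreover have "\<sigma> z = z ^ a" using \<sigma>[of "[:0, 1:]"] by (simp add: map_poly_pCons)
  ultimately show ?thesis by (auto simp: L_def)
qed

text \<open>Turns the sum over the group into a sum over powers of \<open>z\<close>. Injectivity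
  uses extensionality: agreement on the field becomes equality of functions.\<close>

lemma bij_betw_galois_group_roots:
  assumes prim: "primitive_root_of_unity m z"
  shows "bij_betw (\<lambda>\<sigma>. \<sigma> z) (galois_group (rat_adjoin z) \<rat>) ((\<lambda>a. z ^ a) ` {a. a < m \<and> coprime a m})"
proof (rule bij_betw_imageI)
  have m: "m > 0" "z ^ m = 1" using prim by (auto simp: primitive_root_of_unity_def)
  note L = rat_adjoin_root_of_unity[OF m]
  show "inj_on (\<lambda>\<sigma>. \<sigma> z) (galois_group (rat_adjoin z) \<rat>)"
  proof (rule inj_onI)
    fix \<sigma> \<tau> assume \<sigma>: "\<sigma> \<in> galois_group (rat_adjoin z) \<rat>" and \<tau>: "\<tau> \<in> galois_group (rat_adjoin z) \<rat>"
      and eq: "\<sigma> z = \<tau> z"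
    show "\<sigma> = \<tau>"
    proof (rule extensionalityI)
      show "\<sigma> \<in> extensional (rat_adjoin z)" "\<tau> \<in> extensional (rat_adjoin z)"
        using \<sigma> \<tau> by (simp_all add: galois_group_iff)
      fix x assume "x \<in> rat_adjoin z"
      then obtain p where "x = rat_eval p z" by (auto simp: L)
      then show "\<sigma> x = \<tau> x"
        using galois_group_rat_eval[OF L \<sigma>] galois_group_rat_eval[OF L \<tau>] eq by simp
    qed
  qed
  show "(\<lambda>\<sigma>. \<sigma> z) ` galois_group (rat_adjoin z) \<rat> = (\<lambda>a. z ^ a) ` {a. a < m \<and> coprime a m}"
  proof (intro equalityI subsetI)
    fix w assume "w \<in> (\<lambda>\<sigma>. \<sigma> z) ` galois_group (rat_adjoin z) \<rat>"
    then show "w \<in> (\<lambda>a. z ^ a) ` {a. a < m \<and> coprime a m}"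
      using galois_group_apply_root[OF prim] by fastforce
  next
    fix w assume "w \<in> (\<lambda>a. z ^ a) ` {a. a < m \<and> coprime a m}"
    then show "w \<in> (\<lambda>\<sigma>. \<sigma> z) ` galois_group (rat_adjoin z) \<rat>"
      using galois_group_exists_power[OF prim] by (auto simp: image_iff) metis
  qed
qed

lemma cyclotomic_trace_rat_eval:
  assumes prim: "primitive_root_of_unity m z"
  shows "cyclotomic_trace z (rat_eval p z) = (\<Sum>a | a < m \<and> coprime a m. rat_eval p (z ^ a))"
proof -
  have m: "m > 0" "z ^ m = 1" using prim by (auto simp: primitive_root_of_unity_def)
  note L = rat_adjoin_root_of_unity[OF m]
  have "cyclotomic_trace z (rat_eval p z) =
      (\<Sum>\<sigma>\<in>galois_group (rat_adjoin z) \<rat>. rat_eval p (\<sigma> z))"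
    unfolding cyclotomic_trace_def by (intro sum.cong refl galois_group_rat_eval[OF L])
  also have "\<dots> = (\<Sum>w\<in>(\<lambda>a. z ^ a) ` {a. a < m \<and> coprime a m}. rat_eval p w)"
    by (rule sum.reindex_bij_betw[OF bij_betw_galois_group_roots[OF prim]])
  also have "\<dots> = (\<Sum>a | a < m \<and> coprime a m. rat_eval p (z ^ a))"
    by (subst sum.reindex)
       (auto intro: inj_on_subset[OF primitive_root_of_unity_inj_on[OF prim]])
  finally show ?thesis .
qed

subsection \<open>Moebius inversion and Ramanujan sums\<close>

text \<open>Only squarefree divisors contribute, and these are the products of the sets of prime
  factors of \<open>n\<close>. The resulting alternating sum over subsets expands a product of
  factors \<open>1 - 1\<close>, which is empty exactly for \<open>n = 1\<close>.\<close>

lemma sum_moebius_mu_divisors: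
  assumes "n > 0"
  shows "(\<Sum>e | e dvd n. moebius_mu e) = (if n = 1 then 1 else 0)"
proof -
  let ?A = "prime_factors n"
  have pr: "prime p" if "p \<in> ?A" for p using that by (simp add: in_prime_factors_iff)
  have sub: "finite S" "\<And>p. p \<in> S \<Longrightarrow> prime p" if "S \<in> Pow ?A" for S
    using that pr by (auto intro: finite_subset[of S ?A])
  have pf: "prime_factors (\<Prod>S) = S" if "S \<in> Pow ?A" for S
  proof -
    have "\<Prod>S \<noteq> 0" using sub[OF that] by (auto dest: prime_gt_0_nat)
    moreover have "q dvd \<Prod>S \<longleftrightarrow> q \<in> S" if "prime q" for q
      using sub[OF \<open>S \<in> Pow ?A\<close>] that primes_dvd_imp_eq
      by (auto simp: prime_dvd_prod_iff intro: dvd_refl)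
    ultimately show ?thesis using sub(2)[OF that] by (auto simp: in_prime_factors_iff)
  qed
  have sqf: "squarefree (\<Prod>S)" if "S \<in> Pow ?A" for S
    using sub[OF that]
    by (intro squarefree_prod_coprime) (auto intro: squarefree_prime primes_coprime)
  have bij: "bij_betw \<Prod> (Pow ?A) {e. e dvd n \<and> squarefree e}"
  proof (rule bij_betw_imageI)
    show "inj_on \<Prod> (Pow ?A)" by (metis inj_onI pf)
    show "\<Prod> ` Pow ?A = {e. e dvd n \<and> squarefree e}"
    proof (intro equalityI subsetI)
      fix e assume "e \<in> \<Prod> ` Pow ?A"
      then obtain S where S: "S \<in> Pow ?A" "e = \<Prod>S" by auto
      have "\<Prod>S dvd \<Prod>?A" using S by (intro prod_dvd_prod_subset) auto
      also have "\<dots> dvd (\<Prod>p\<in>?A. p ^ multiplicity p n)"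
        by (intro prod_dvd_prod) (auto simp: prime_factors_multiplicity intro!: dvd_power)
      also have "\<dots> = n" using prime_factorization_nat[of n] assms by simp
      finally have "\<Prod>S dvd n" .
      then show "e \<in> {e. e dvd n \<and> squarefree e}" using S sqf by simp
    next
      fix e assume e: "e \<in> {e. e dvd n \<and> squarefree e}"
      then have "e > 0" using assms by (auto intro: Nat.gr0I)
      have "e = (\<Prod>p\<in>prime_factors e. p ^ multiplicity p e)"
        using \<open>e > 0\<close> by (metis prime_factorization_nat)
      also have "\<dots> = \<Prod>(prime_factors e)"
      proof (rule prod.cong[OF refl])
        fix p assume p: "p \<in> prime_factors e"
        then have "multiplicity p e \<noteq> 0" by (simp add: prime_factors_multiplicity)
        moreover have "multiplicity p e \<le> 1"
          using e p by (auto simp: squarefree_factorial_semiring'' in_prime_factors_iff)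
        ultimately have "multiplicity p e = 1" by linarith
        then show "p ^ multiplicity p e = p" by simp
      qed
      finally have "e = \<Prod>(prime_factors e)" .
      moreover have "prime_factors e \<subseteq> ?A"
        using e assms by (intro dvd_prime_factors) auto
      ultimately show "e \<in> \<Prod> ` Pow ?A" by blast
    qed
  qed
  have "(\<Sum>e | e dvd n. moebius_mu e) = (\<Sum>e | e dvd n \<and> squarefree e. moebius_mu e)"
    using assms by (intro sum.mono_neutral_right) (auto simp: moebius_mu_def)
  also have "\<dots> = (\<Sum>S\<in>Pow ?A. moebius_mu (\<Prod>S))"
    by (rule sum.reindex_bij_betw[OF bij, symmetric])
  also have "\<dots> = (\<Sum>S\<in>Pow ?A. (-1) ^ card S)"
    by (rule sum.cong) (simp_all only: moebius_mu_def sqf pf if_True)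
  also have "\<dots> = (\<Prod>p\<in>?A. 1 - 1)"
    by (subst prod_diff_conv_sum) simp_all
  also have "\<dots> = (if n = 1 then 1 else 0)"
    using assms by (simp add: prime_factorization_empty_iff power_0_left card_eq_0_iff)
  finally show ?thesis .
qed

text \<open>The indicator of coprimality is the Moebius sum over the common divisors
  \<open>e\<close> of \<open>a\<close> and \<open>m\<close>; after exchanging the sums,
  \<open>a\<close> runs through the multiples \<open>e * b\<close>.\<close>

lemma sum_coprime_eq_sum_divisors:
  fixes f :: "nat \<Rightarrow> complex"
  assumes "m > 0"
  shows "(\<Sum>a | a < m \<and> coprime a m. f a) =
    (\<Sum>e | e dvd m. of_int (moebius_mu e) * (\<Sum>b<m div e. f (e * b)))"
proof -
  have fin: "finite {e. e dvd m}" using assms by simp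
  have "(\<Sum>a | a < m \<and> coprime a m. f a) = (\<Sum>a<m. if coprime a m then f a else 0)"
    by (subst sum.inter_filter[symmetric]) (auto intro: sum.cong)
  also have "\<dots> = (\<Sum>a<m. \<Sum>e | e dvd m \<and> e dvd a. of_int (moebius_mu e) * f a)"
  proof (rule sum.cong[OF refl])
    fix a assume "a \<in> {..<m}"
    have "{e. e dvd m \<and> e dvd a} = {e. e dvd gcd a m}" by auto
    then have "(\<Sum>e | e dvd m \<and> e dvd a. of_int (moebius_mu e) * f a) =
        of_int (\<Sum>e | e dvd gcd a m. moebius_mu e) * f a"
      by (simp add: sum_distrib_right)
    also have "\<dots> = (if coprime a m then f a else 0)"
      using assms by (subst sum_moebius_mu_divisors) (auto simp: coprime_iff_gcd_eq_1)
    finally show "(if coprime a m then f a else 0) =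
        (\<Sum>e | e dvd m \<and> e dvd a. of_int (moebius_mu e) * f a)" by simp
  qed
  also have "\<dots> = (\<Sum>a<m. \<Sum>e | e \<in> {e. e dvd m} \<and> e dvd a. of_int (moebius_mu e) * f a)"
    by simp
  also have "\<dots> = (\<Sum>e | e dvd m. \<Sum>a | a \<in> {..<m} \<and> e dvd a. of_int (moebius_mu e) * f a)"
    by (rule sum.swap_restrict) (use fin in auto)
  also have "\<dots> = (\<Sum>e | e dvd m. of_int (moebius_mu e) * (\<Sum>b<m div e. f (e * b)))"
  proof (rule sum.cong[OF refl])
    fix e assume "e \<in> {e. e dvd m}"
    then obtain k where k: "m = e * k" by auto
    then have e: "e > 0" using assms by auto
    have "bij_betw (\<lambda>b. e * b) {..<m div e} {a. a \<in> {..<m} \<and> e dvd a}"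
      by (rule bij_betwI[where g = "\<lambda>a. a div e"]) (use e in \<open>auto simp: k\<close>)
    then show "(\<Sum>a | a \<in> {..<m} \<and> e dvd a. of_int (moebius_mu e) * f a) =
        of_int (moebius_mu e) * (\<Sum>b<m div e. f (e * b))"
      by (simp add: sum_distrib_left sum.reindex_bij_betw[symmetric])
  qed
  finally show ?thesis .
qed

text \<open>Both sides range over the pairs with \<open>g\<close> dividing \<open>m\<close> and
  \<open>e * g\<close> dividing \<open>d\<close>.\<close>

lemma sum_swap_divisor_pairs:
  fixes f :: "nat \<Rightarrow> nat \<Rightarrow> complex"
  assumes "d > 0" "m > 0"
  shows "(\<Sum>e | e dvd d. \<Sum>g | g dvd m \<and> g dvd d div e. f e g) =
         (\<Sum>g | g dvd m \<and> g dvd d. \<Sum>e | e dvd d div g. f e g)"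
proof -
  have dvd_div: "g dvd d div e \<longleftrightarrow> e dvd d div g" if "g dvd d" "e dvd d" for e g
    using that assms by (metis div_dvd_iff_mult dvd_div_iff_mult dvd_0_left_iff gr0_conv_Suc mult.commute old.nat.distinct(2))
  have dvd_div_dvd: "g dvd d" if "g dvd d div e" "e dvd d" for e g
    using that by (metis dvd_div_mult_self dvd_mult2)
  have "(\<Sum>e | e dvd d. \<Sum>g | g dvd m \<and> g dvd d div e. f e g) =
      (\<Sum>e | e dvd d. \<Sum>g | g \<in> {g. g dvd m \<and> g dvd d} \<and> g dvd d div e. f e g)"
    by (intro sum.cong refl) (auto dest: dvd_div_dvd)
  also have "\<dots> = (\<Sum>g | g dvd m \<and> g dvd d. \<Sum>e | e \<in> {e. e dvd d} \<and> g dvd d div e. f e g)"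
    by (rule sum.swap_restrict) (use assms in auto)
  also have "\<dots> = (\<Sum>g | g dvd m \<and> g dvd d. \<Sum>e | e dvd d div g. f e g)"
  proof (rule sum.cong[OF refl])
    fix g assume g: "g \<in> {g. g dvd m \<and> g dvd d}"
    have "{e. e \<in> {e. e dvd d} \<and> g dvd d div e} = {e. e dvd d div g}"
      using g dvd_div dvd_div_dvd by blast
    then show "(\<Sum>e | e \<in> {e. e dvd d} \<and> g dvd d div e. f e g) = (\<Sum>e | e dvd d div g. f e g)"
      by simp
  qed
  finally show ?thesis .
qed

text \<open>Ramanujan's sum. Moebius inversion, indexed by the complementary divisor
  \<open>g\<close>, leaves complete geometric sums over the powers of a \<open>g\<close>-th root of
  unity.\<close>

lemma sum_coprime_powers_primitive_root:
  assumes prim: "primitive_root_of_unity m z"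
  shows "(\<Sum>a | a < m \<and> coprime a m. (z ^ a) ^ k) =
    (\<Sum>g | g dvd m \<and> g dvd k. of_nat g * of_int (moebius_mu (m div g)))"
proof -
  have m: "m > 0" "z ^ m = 1" using prim by (auto simp: primitive_root_of_unity_def)
  have geom: "(\<Sum>b<g. (z ^ (m div g * b)) ^ k) = (if g dvd k then of_nat g else 0)" if "g dvd m" for g
  proof -
    from that obtain e where e: "m = g * e" by auto
    have pos: "g > 0" "e > 0" using m e by auto
    \<comment> \<open>The ratio of the geometric sum: \<open>w ^ g = 1\<close>, and
      \<open>w = 1\<close> exactly when \<open>g\<close> divides \<open>k\<close>, so the sum is
      \<open>g\<close> or 0.\<close>
    define w where "w = z ^ (e * k)"
    have w1: "w = 1 \<longleftrightarrow> g dvd k"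
      using pos by (simp add: w_def primitive_root_of_unity_power_eq_1_iff[OF prim] e mult.commute)
    have "w ^ g = z ^ (m * k)" by (simp add: w_def e ac_simps flip: power_mult)
    then have wg: "w ^ g = 1" using m by (simp add: power_mult)
    have "(z ^ (m div g * b)) ^ k = w ^ b" for b
      using pos by (simp add: w_def e ac_simps flip: power_mult)
    then have "(\<Sum>b<g. (z ^ (m div g * b)) ^ k) = (\<Sum>b<g. w ^ b)" by simp
    also have "\<dots> = (if g dvd k then of_nat g else 0)"
      using w1 wg by (auto simp: sum_gp_strict)
    finally show ?thesis .
  qed
  have fin: "finite {g. g dvd m}" using m by simp
  have "(\<Sum>a | a < m \<and> coprime a m. (z ^ a) ^ k) =
      (\<Sum>e | e dvd m. of_int (moebius_mu e) * (\<Sum>b<m div e. (z ^ (e * b)) ^ k))"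
    by (rule sum_coprime_eq_sum_divisors[OF m(1)])
  also have "\<dots> = (\<Sum>g | g dvd m. of_int (moebius_mu (m div g)) * (\<Sum>b<g. (z ^ (m div g * b)) ^ k))"
    by (rule sum.reindex_bij_witness[of _ "\<lambda>g. m div g" "\<lambda>g. m div g"]) (use m in \<open>auto elim!: dvdE\<close>)
  also have "\<dots> = (\<Sum>g | g dvd m. if g dvd k then of_nat g * of_int (moebius_mu (m div g)) else 0)"
    by (rule sum.cong) (simp_all add: geom)
  also have "\<dots> = (\<Sum>g | g dvd m \<and> g dvd k. of_nat g * of_int (moebius_mu (m div g)))"
    using fin by (simp add: sum.inter_filter[symmetric])
  finally show ?thesis .
qed

lemma rat_eval_necklace_poly:
  "rat_eval (necklace_poly d) w = (\<Sum>e | e dvd d. of_int (moebius_mu e) * w ^ (d div e)) / of_nat d"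
  by (simp add: necklace_poly_def map_poly_of_rat map_poly_monom poly_sum poly_monom of_rat_divide)

theorem theorem2p31:
  fixes m d :: nat and \<zeta> :: complex
  assumes "m \<ge> 1" and "d \<ge> 1"
    and "primitive_root_of_unity m \<zeta>"
  shows "cyclotomic_trace \<zeta> (poly (map_poly of_rat (necklace_poly d)) \<zeta>) =
           (if d dvd m then of_int (moebius_mu (m div d)) else 0)"
proof -
  let ?U = "{a. a < m \<and> coprime a m}"
  let ?h = "\<lambda>g. of_nat g * of_int (moebius_mu (m div g)) :: complex"
  \<comment> \<open>The factor \<open>d\<close> clears the denominator of the necklace polynomial
    and is cancelled at the end against the \<open>d\<close> in \<open>?h d\<close>.\<close>
  have "of_nat d * cyclotomic_trace \<zeta> (rat_eval (necklace_poly d) \<zeta>) =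
      of_nat d * (\<Sum>a\<in>?U. (\<Sum>e | e dvd d. of_int (moebius_mu e) * (\<zeta> ^ a) ^ (d div e)) / of_nat d)"
    unfolding cyclotomic_trace_rat_eval[OF assms(3)] by (simp only: rat_eval_necklace_poly)
  also have "\<dots> = (\<Sum>a\<in>?U. \<Sum>e | e dvd d. of_int (moebius_mu e) * (\<zeta> ^ a) ^ (d div e))"
    using assms(2) by (simp flip: sum_divide_distrib)
  also have "\<dots> = (\<Sum>e | e dvd d. of_int (moebius_mu e) * (\<Sum>a\<in>?U. (\<zeta> ^ a) ^ (d div e)))"
    by (subst sum.swap) (simp add: sum_distrib_left)
  also have "\<dots> = (\<Sum>e | e dvd d. \<Sum>g | g dvd m \<and> g dvd d div e. of_int (moebius_mu e) * ?h g)"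
    by (simp only: sum_coprime_powers_primitive_root[OF assms(3)] sum_distrib_left)
  also have "\<dots> = (\<Sum>g | g dvd m \<and> g dvd d. \<Sum>e | e dvd d div g. of_int (moebius_mu e) * ?h g)"
    by (rule sum_swap_divisor_pairs) (use assms in auto)
  \<comment> \<open>The inner sum of Moebius values over the divisors of \<open>d div g\<close>
    vanishes unless \<open>g = d\<close>.\<close>
  also have "\<dots> = (\<Sum>g | g dvd m \<and> g dvd d. if g = d then ?h d else 0)"
  proof (rule sum.cong[OF refl])
    fix g assume "g \<in> {g. g dvd m \<and> g dvd d}"
    then obtain k where k: "d = g * k" by auto
    then have pos: "g > 0" "k > 0" using assms(2) by (auto intro: Nat.gr0I)
    have "(\<Sum>e | e dvd d div g. of_int (moebius_mu e) * ?h g) =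
        of_int (\<Sum>e | e dvd d div g. moebius_mu e) * ?h g"
      by (simp add: sum_distrib_right)
    also have "\<dots> = (if k = 1 then ?h g else 0)"
      using pos by (simp add: k sum_moebius_mu_divisors)
    finally show "(\<Sum>e | e dvd d div g. of_int (moebius_mu e) * ?h g) = (if g = d then ?h d else 0)"
      using pos by (auto simp: k)
  qed
  also have "\<dots> = (if d dvd m then ?h d else 0)"
    using assms by (subst sum.delta) auto
  finally show ?thesis using assms(2) by (auto split: if_splits)
qed

end
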